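(* For a constant $c$ and $m\ge1$ let $H_{m;c}(x)=H_m(x)+c\,H_{m-1}(x)$. Let $n\ge2$ be an integer and let $s,t$ be constants. Then \[ \operatorname{Res}(H_{n;s},H_{n-1;t})=\frac{(-1)^{n(n+1)/2}2^{n(3n-5)/2}}{(n-1)^n}\prod_{k=1}^{n-1}k^k\cdot t^nH_{n;s}\!\left(-\frac{2(n-1)+st}{2t}\right). \]
   Context: $H_n$ is the $n$-th (physicists') Hermite polynomial, $H_n(x)=(-1)^ne^{x^2}\frac{d^n}{dx^n}e^{-x^2}=\sum_{k=0}^{\lfloor n/2\rfloor}(-1)^k\frac{n!}{k!(n-2k)!}(2x)^{n-2k}$. Constants are real or complex numbers. For $f=a_0\prod_{i=1}^n(x-\alpha_i)$ of degree $n$ and $g=b_0\prod_{j=1}^m(x-\beta_j)$ of degree $m$, $\operatorname{Res}(f,g)=a_0^mb_0^n\prod_{i,j}(\alpha_i-\beta_j)$. The factor $t^nH_{n;s}(\cdots)$ is a polynomial in $t$; at $t=0$ it denotes the value of that polynomial. *)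

theory Defs
  imports "HOL-Analysis.Analysis" "HOL-Computational_Algebra.Computational_Algebra"
begin

(* Physicists' convention; for the Rodrigues formula see hermite_Rodrigues. *)
definition hermite :: "nat \<Rightarrow> complex poly" where
  "hermite n = (\<Sum>k\<le>n div 2. smult ((-1) ^ k * fact n / (fact k * fact (n - 2 * k)))
                                ([:0, 2:] ^ (n - 2 * k)))"

(* Only meaningful for m \<ge> 1: for m = 0 the truncated subtraction gives hermite 0. *)
definition hermite_pert :: "nat \<Rightarrow> complex \<Rightarrow> complex poly" where
  "hermite_pert m c = hermite m + smult c (hermite (m - 1))"

(* proots is the multiset of roots, counted with multiplicity; over the complex numbers
   it has degree f elements, so this is the product formula for the resultant (see Res_prod). *)
definition Res :: "complex poly \<Rightarrow> complex poly \<Rightarrow> complex" where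
  "Res f g = lead_coeff f ^ degree g * lead_coeff g ^ degree f *
               (\<Prod>\<alpha>\<in>#proots f. \<Prod>\<beta>\<in>#proots g. \<alpha> - \<beta>)"

(* The polynomial in t that equals t^n H_{n;s}(-(2(n-1)+st)/(2t)) for every t \<noteq> 0.
   Existence and uniqueness: hermite_factor_ex1. *)
definition hermite_factor :: "nat \<Rightarrow> complex \<Rightarrow> complex poly" where
  "hermite_factor n s = (THE P. \<forall>t. t \<noteq> 0 \<longrightarrow>
     poly P t = t ^ n * poly (hermite_pert n s) (- (2 * (of_nat n - 1) + s * t) / (2 * t)))"

lemma linear_power_monom: "([:0, 2:] :: complex poly) ^ j = monom (2 ^ j) j"
proof -
  have "([:0, 2:] :: complex poly) = monom 2 1" by (simp add: monom_altdef)
  then show ?thesis by (simp add: monom_power)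
qed

lemma coeff_hermite_eq:
  "coeff (hermite (i + 2 * k)) i = (-1) ^ k * fact (i + 2 * k) / (fact k * fact i) * 2 ^ i"
proof -
  have "coeff (hermite (i + 2 * k)) i =
      (\<Sum>l\<le>(i + 2 * k) div 2. if l = k then (-1) ^ k * fact (i + 2 * k) / (fact k * fact i) * 2 ^ i else 0)"
    unfolding hermite_def coeff_sum
  proof (rule sum.cong, goal_cases)
    case (2 l)
    then have "i + 2 * k - 2 * l = i \<longleftrightarrow> l = k" by auto
    then show ?case by (auto simp: linear_power_monom)
  qed simp
  then show ?thesis by simp
qed

lemma coeff_hermite_0:
  assumes "\<And>k. n \<noteq> i + 2 * k"
  shows "coeff (hermite n) i = 0"
  unfolding hermite_def coeff_sum
proof (rule sum.neutral, safe)
  fix l assume "l \<le> n div 2"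
  then have "n - 2 * l \<noteq> i" using assms[of l] by auto
  then show "coeff (smult ((-1) ^ l * fact n / (fact l * fact (n - 2 * l)) :: complex) ([:0, 2:] ^ (n - 2 * l))) i = 0"
    by (simp add: linear_power_monom)
qed

lemma degree_hermite: "degree (hermite n) = n"
proof (rule antisym)
  show "degree (hermite n) \<le> n"
    by (rule degree_le) (auto intro!: coeff_hermite_0)
  show "n \<le> degree (hermite n)"
    using coeff_hermite_eq[of n 0] by (intro le_degree) simp
qed

lemma hermite_Suc: "hermite (Suc n) = [:0, 2:] * hermite n - pderiv (hermite n)"
proof (rule poly_eqI)
  fix i
  show "coeff (hermite (Suc n)) i = coeff ([:0, 2:] * hermite n - pderiv (hermite n)) i"
  proof (cases "\<exists>k. Suc n = i + 2 * k")
    case False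
    have "coeff (hermite (Suc n)) i = 0" using False by (intro coeff_hermite_0) auto
    moreover have "coeff (hermite n) (Suc i) = 0"
    proof (rule coeff_hermite_0)
      fix k show "n \<noteq> Suc i + 2 * k" using False by (auto dest: spec[of _ "Suc k"])
    qed
    moreover have "i = 0 \<or> coeff (hermite n) (i - 1) = 0"
    proof (cases i)
      case (Suc j)
      have "coeff (hermite n) j = 0" using False Suc by (intro coeff_hermite_0) auto
      then show ?thesis using Suc by simp
    qed simp
    ultimately show ?thesis
      by (cases i) (auto simp: coeff_pderiv coeff_pCons)
  next
    case True
    then obtain k where k: "Suc n = i + 2 * k" by blast
    have lhs: "coeff (hermite (Suc n)) i =
        (of_nat i + 2 * of_nat k) * ((-1) ^ k * fact n / (fact k * fact i) * 2 ^ i)"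
    proof -
      have "fact (i + 2 * k) = (of_nat i + 2 * of_nat k :: complex) * fact n"
        unfolding k[symmetric] fact_Suc of_nat_mult using k by (metis of_nat_add of_nat_mult of_nat_numeral)
      then show ?thesis unfolding k coeff_hermite_eq by simp
    qed
    have a: "coeff ([:0, 2:] * hermite n) i = of_nat i * ((-1) ^ k * fact n / (fact k * fact i) * 2 ^ i)"
    proof (cases i)
      case (Suc j)
      then have n: "n = j + 2 * k" using k by simp
      have "coeff (hermite n) j = (-1) ^ k * fact n / (fact k * fact j) * 2 ^ j"
        unfolding n by (rule coeff_hermite_eq)
      moreover have "(of_nat i :: complex) \<noteq> 0" "fact i = (of_nat i * fact j :: complex)"
        using Suc of_nat_neq_0[of j] by auto
      ultimately show ?thesis using Suc by (simp del: of_nat_Suc fact_Suc)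
    qed simp
    have b: "coeff (pderiv (hermite n)) i = - 2 * of_nat k * ((-1) ^ k * fact n / (fact k * fact i) * 2 ^ i)"
    proof (cases k)
      case 0
      have "coeff (hermite n) (Suc i) = 0" using k 0 by (intro coeff_hermite_0) auto
      then show ?thesis using 0 by (simp add: coeff_pderiv)
    next
      case (Suc l)
      then have n: "n = Suc i + 2 * l" using k by simp
      have "coeff (hermite n) (Suc i) = (-1) ^ l * fact n / (fact l * fact (Suc i)) * 2 ^ Suc i"
        unfolding n by (rule coeff_hermite_eq)
      moreover have "(of_nat k :: complex) \<noteq> 0" "fact k = (of_nat k * fact l :: complex)"
        using Suc of_nat_neq_0[of l] by auto
      moreover have "(of_nat (Suc i) :: complex) \<noteq> 0" "fact (Suc i) = (of_nat (Suc i) * fact i :: complex)"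
        using of_nat_neq_0[of i] by auto
      moreover have "(-1 :: complex) ^ k = - ((-1) ^ l)" using Suc by simp
      ultimately show ?thesis unfolding coeff_pderiv by (simp del: of_nat_Suc fact_Suc)
    qed
    show ?thesis unfolding coeff_diff lhs a b by (simp add: algebra_simps add_divide_distrib)
  qed
qed

lemma hermite_Rodrigues:
  "poly (hermite n) x = (-1) ^ n * exp (x\<^sup>2) * (deriv ^^ n) (\<lambda>z. exp (- z\<^sup>2)) x"
proof -
  have "(deriv ^^ n) (\<lambda>z. exp (- z\<^sup>2)) = (\<lambda>z. (-1) ^ n * poly (hermite n) z * exp (- z\<^sup>2))"
  proof (induction n)
    case 0
    show ?case by (simp add: hermite_def)
  next
    case (Suc n)
    have "((\<lambda>z. (-1) ^ n * poly (hermite n) z * exp (- z\<^sup>2)) has_field_derivative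
            (-1) ^ Suc n * poly (hermite (Suc n)) z * exp (- z\<^sup>2)) (at z)" for z
      by (rule derivative_eq_intros poly_DERIV refl)+ (simp add: hermite_Suc algebra_simps)
    then show ?case by (simp add: Suc DERIV_imp_deriv fun_eq_iff)
  qed
  then show ?thesis by (simp flip: exp_add power_mult_distrib add: mult.assoc mult.left_commute)
qed

lemma Res_prod:
  assumes "a \<noteq> 0" "b \<noteq> 0"
  shows "Res (smult a (\<Prod>i<n. [:- \<alpha> i, 1:])) (smult b (\<Prod>j<m. [:- \<beta> j, 1:])) =
           a ^ m * b ^ n * (\<Prod>i<n. \<Prod>j<m. \<alpha> i - \<beta> j)"
proof -
  have *: "proots (\<Prod>i<k. [:- \<gamma> i, 1:]) = image_mset \<gamma> (mset_set {..<k})"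
    "degree (\<Prod>i<k. [:- \<gamma> i, 1:]) = k" "coeff (\<Prod>i<k. [:- \<gamma> i, 1:]) k = 1"
    for k and \<gamma> :: "nat \<Rightarrow> complex"
  proof -
    show "proots (\<Prod>i<k. [:- \<gamma> i, 1:]) = image_mset \<gamma> (mset_set {..<k})"
      by (subst proots_prod) (auto simp: sum_unfold_sum_mset)
    show deg: "degree (\<Prod>i<k. [:- \<gamma> i, 1:]) = k"
      by (subst degree_prod_sum_eq) auto
    have "lead_coeff (\<Prod>i<k. [:- \<gamma> i, 1:]) = 1"
      by (subst lead_coeff_prod) simp
    then show "coeff (\<Prod>i<k. [:- \<gamma> i, 1:]) k = 1"
      by (simp add: deg)
  qed
  show ?thesis
    unfolding Res_def degree_smult_eq proots_smult[OF assms(1)] proots_smult[OF assms(2)] coeff_smult *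
    using assms by (simp add: *) (simp add: image_mset.compositionality o_def prod_unfold_prod_mset)
qed

lemma hermite_factor_ex1:
  "\<exists>!P. \<forall>t. t \<noteq> 0 \<longrightarrow>
     poly P t = t ^ n * poly (hermite_pert n s) (- (2 * (of_nat n - 1) + s * t) / (2 * t))"
proof -
  define h where "h = hermite_pert n s"
  have deg: "degree h \<le> n"
    unfolding h_def hermite_pert_def
    by (rule degree_add_le) (auto simp: degree_hermite intro: order_trans[OF degree_smult_le])
  define P where "P = (\<Sum>k\<le>n. smult (coeff h k) ([:- (of_nat n - 1), - s / 2:] ^ k * monom 1 (n - k)))"
  have P: "poly P t = t ^ n * poly h (- (2 * (of_nat n - 1) + s * t) / (2 * t))" if "t \<noteq> 0" for t
  proof -
    let ?u = "- (2 * (of_nat n - 1) + s * t) / (2 * t)"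
    have u: "- (of_nat n - 1) + t * (- s / 2) = ?u * t" using that by (simp add: field_simps)
    have "poly P t = (\<Sum>k\<le>n. coeff h k * ((?u * t) ^ k * t ^ (n - k)))"
      unfolding P_def poly_sum poly_smult poly_mult poly_power poly_monom poly_pCons poly_0 mult_zero_right add_0_right mult_1 u ..
    also have "\<dots> = (\<Sum>k\<le>n. t ^ n * (coeff h k * ?u ^ k))"
    proof (rule sum.cong)
      fix k assume "k \<in> {..n}"
      then have "t ^ n = t ^ k * t ^ (n - k)" by (simp flip: power_add)
      then show "coeff h k * ((?u * t) ^ k * t ^ (n - k)) = t ^ n * (coeff h k * ?u ^ k)"
        by (simp only: power_mult_distrib mult_ac)
    qed simp
    also have "\<dots> = t ^ n * poly h ?u"
      using deg by (simp add: poly_altdef sum_distrib_left)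
        (rule sum.mono_neutral_right; use le_degree in auto)
    finally show ?thesis .
  qed
  show ?thesis
  proof (rule ex1I[of _ P])
    show "\<forall>t. t \<noteq> 0 \<longrightarrow>
        poly P t = t ^ n * poly (hermite_pert n s) (- (2 * (of_nat n - 1) + s * t) / (2 * t))"
      using P by (simp add: h_def)
  next
    fix Q assume "\<forall>t. t \<noteq> 0 \<longrightarrow>
        poly Q t = t ^ n * poly (hermite_pert n s) (- (2 * (of_nat n - 1) + s * t) / (2 * t))"
    then have "UNIV - {0} \<subseteq> {t. poly (Q - P) t = 0}" using P by (auto simp: h_def)
    moreover have "infinite (UNIV - {0 :: complex})"
      by (simp add: infinite_UNIV_char_0)
    ultimately have "infinite {t. poly (Q - P) t = 0}" using finite_subset by blast
    then show "Q = P" using poly_roots_finite[of "Q - P"] by auto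
  qed
qed

lemma poly_hermite_factor:
  assumes "t \<noteq> 0"
  shows "poly (hermite_factor n s) t =
           t ^ n * poly (hermite_pert n s) (- (2 * (of_nat n - 1) + s * t) / (2 * t))"
  using theI'[OF hermite_factor_ex1[of n s]] assms unfolding hermite_factor_def by blast

end

theory Submission
  imports Defs
begin

text \<open>
  Write \<open>f = H\<^sub>n + s H\<^sub>n\<^sub>-\<^sub>1\<close>, \<open>m = n - 1\<close> and \<open>g = H\<^sub>m + t H\<^sub>m\<^sub>-\<^sub>1\<close>. Up to powers of the leading
  coefficients and a sign, the resultant of \<open>f\<close> and \<open>g\<close> is the product of the values of \<open>f\<close> over
  the roots of \<open>g\<close> (\<open>Res_prod_right\<close>), so only \<open>f\<close> modulo \<open>g\<close> matters. Let \<open>t \<noteq> 0\<close>. The recurrence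
  \<open>H\<^sub>n = 2 x H\<^sub>m - 2 m H\<^sub>m\<^sub>-\<^sub>1\<close> gives, with \<open>u = -(2 m + s t) / (2 t)\<close>,
  \<open>f = 2 (x - u) H\<^sub>m - (2 m / t) g\<close>.
  This identity is used in two ways. At a root \<open>\<beta>\<close> of \<open>g\<close> it reads \<open>f(\<beta>) = 2 (\<beta> - u) H\<^sub>m(\<beta>)\<close>; the
  product of the linear factors over all \<open>\<beta>\<close> is \<open>g(u)\<close> up to a constant. At \<open>x = u\<close> it says that
  \<open>g(u)\<close> is a multiple of \<open>f(u)\<close>, which is where the value of \<open>f\<close> at the special point comes from.

  What remains is the product of \<open>H\<^sub>m\<close> over the roots of \<open>g\<close>, essentially the resultant of \<open>H\<^sub>m\<close> and
  \<open>H\<^sub>m + t H\<^sub>m\<^sub>-\<^sub>1\<close>. Evaluated over the roots of \<open>H\<^sub>m\<close> instead, it is, up to a power of two and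
  a sign, \<open>t\<^sup>m\<close> times the resultant of \<open>H\<^sub>m\<close> and \<open>H\<^sub>m\<^sub>-\<^sub>1\<close> (\<open>prod_hermite_proots_pert\<close>). The latter follows by induction from the same
  recurrence (\<open>Res_hermite\<close>), and this is the source of the product of the \<open>k\<^sup>k\<close>.

  The case \<open>t = 0\<close> follows because both sides are polynomials in \<open>t\<close> that agree at every nonzero
  \<open>t\<close>. On the left this is visible from the product of the values of \<open>g\<close> over the roots of \<open>f\<close>,
  which do not depend on \<open>t\<close>; the degree of \<open>g\<close> does not depend on \<open>t\<close> either
  (\<open>Res_hermite_pert_poly\<close>).
\<close>

lemma poly_conv_prod_proots:
  fixes p :: "complex poly"
  shows "poly p x = lead_coeff p * (\<Prod>\<alpha>\<in>#proots p. x - \<alpha>)"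
proof -
  have "p = smult (lead_coeff p) (\<Prod>\<alpha>\<in>#proots p. [:-\<alpha>, 1:])"
    by (rule complex_poly_decompose_multiset[symmetric])
  then have "poly p x = poly (smult (lead_coeff p) (\<Prod>\<alpha>\<in>#proots p. [:-\<alpha>, 1:])) x"
    by (rule arg_cong)
  then show ?thesis
    by (simp add: poly_prod_mset image_mset.compositionality o_def)
qed

lemma prod_mset_cmult:
  fixes c :: "'a :: comm_semiring_1"
  shows "(\<Prod>x\<in>#M. c * f x) = c ^ size M * (\<Prod>x\<in>#M. f x)"
  by (simp add: prod_mset.distrib)

lemma Res_prod_left:
  "Res f g = lead_coeff f ^ degree g * (\<Prod>\<alpha>\<in>#proots f. poly g \<alpha>)"
  unfolding Res_def poly_conv_prod_proots[of g] prod_mset_cmult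
  by (simp add: size_proots_complex)

lemma Res_commute: "Res f g = (-1) ^ (degree f * degree g) * Res g f"
proof -
  have swap: "(\<Prod>\<alpha>\<in>#proots f. \<Prod>\<beta>\<in>#proots g. \<alpha> - \<beta>) =
        (-1) ^ (degree f * degree g) * (\<Prod>\<beta>\<in>#proots g. \<Prod>\<alpha>\<in>#proots f. \<beta> - \<alpha>)"
  proof -
    have "(\<Prod>\<alpha>\<in>#proots f. \<Prod>\<beta>\<in>#proots g. \<alpha> - \<beta>) =
          (\<Prod>\<beta>\<in>#proots g. \<Prod>\<alpha>\<in>#proots f. -1 * (\<beta> - \<alpha>))"
      by (subst prod_mset.swap) simp
    also have "\<dots> = (-1) ^ (degree f * degree g) * (\<Prod>\<beta>\<in>#proots g. \<Prod>\<alpha>\<in>#proots f. \<beta> - \<alpha>)"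
      unfolding prod_mset_cmult size_proots_complex by (simp add: power_mult)
    finally show ?thesis .
  qed
  show ?thesis unfolding Res_def swap by simp
qed

lemma Res_prod_right:
  "Res f g = (-1) ^ (degree f * degree g) * lead_coeff g ^ degree f * (\<Prod>\<beta>\<in>#proots g. poly f \<beta>)"
  by (subst Res_commute) (simp add: Res_prod_left mult.commute)

lemma pderiv_hermite: "pderiv (hermite (Suc n)) = smult (2 * of_nat (Suc n)) (hermite n)"
proof (induction n)
  case 0
  show ?case by (simp add: hermite_Suc hermite_def pderiv_mult pderiv_pCons)
next
  case (Suc n)
  have "pderiv (hermite (Suc (Suc n))) =
      smult 2 (hermite (Suc n)) + smult (2 * of_nat (Suc n)) ([:0, 2:] * hermite n - pderiv (hermite n))"
    unfolding hermite_Suc[of "Suc n"] pderiv_diff pderiv_mult Suc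
    by (simp add: pderiv_pCons pderiv_smult algebra_simps smult_diff_right)
  also have "\<dots> = smult (2 * of_nat (Suc (Suc n))) (hermite (Suc n))"
    unfolding hermite_Suc[of n, symmetric] smult_add_left[symmetric] by (simp add: algebra_simps)
  finally show ?case .
qed

text \<open>Since \<open>H\<^sub>n\<close> is an Appell sequence up to scaling (\<open>pderiv_hermite\<close>), the derivative in
  \<open>H\<^sub>n\<^sub>+\<^sub>1 = 2 x H\<^sub>n - H\<^sub>n'\<close> can be replaced by \<open>2 n H\<^sub>n\<^sub>-\<^sub>1\<close>.\<close>
lemma poly_hermite_rec:
  "poly (hermite (Suc (Suc n))) x =
     2 * x * poly (hermite (Suc n)) x - 2 * of_nat (Suc n) * poly (hermite n) x"
  unfolding hermite_Suc[of "Suc n"] pderiv_hermite by simp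

lemma lead_coeff_hermite: "coeff (hermite n) n = 2 ^ n"
  using coeff_hermite_eq[of n 0] by simp

lemma degree_hermite_pert: "degree (hermite_pert (Suc n) c) = Suc n"
  unfolding hermite_pert_def
  by (subst degree_add_eq_left) (auto simp: degree_hermite intro: le_less_trans[OF degree_smult_le])

lemma lead_coeff_hermite_pert: "coeff (hermite_pert (Suc n) c) (Suc n) = 2 ^ Suc n"
  by (simp add: hermite_pert_def lead_coeff_hermite coeff_eq_0 degree_hermite)

text \<open>One step of the Euclidean algorithm: at the roots of \<open>H\<^sub>n\<^sub>+\<^sub>1\<close> the recurrence reduces \<open>H\<^sub>n\<^sub>+\<^sub>2\<close> to
  \<open>-2 (n + 1) H\<^sub>n\<close>. The remaining factor \<open>4\<^bsup>n + 1\<^esup>\<close> is the quotient of the powers of the leading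
  coefficient \<open>2\<^bsup>n + 1\<^esup>\<close> in the two resultants, whose exponents are \<open>n + 2\<close> and \<open>n\<close>.\<close>
lemma Res_hermite_Suc:
  "Res (hermite (Suc (Suc n))) (hermite (Suc n)) =
     (-8 * of_nat (Suc n)) ^ Suc n * Res (hermite (Suc n)) (hermite n)"
proof -
  have "(\<Prod>\<beta>\<in>#proots (hermite (Suc n)). poly (hermite (Suc (Suc n))) \<beta>) =
      (\<Prod>\<beta>\<in>#proots (hermite (Suc n)). (-2 * of_nat (Suc n)) * poly (hermite n) \<beta>)"
  proof (intro arg_cong[where f = prod_mset] image_mset_cong)
    fix \<beta> assume "\<beta> \<in># proots (hermite (Suc n))"
    then have "poly (hermite (Suc n)) \<beta> = 0" by (cases "hermite (Suc n) = 0") auto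
    then show "poly (hermite (Suc (Suc n))) \<beta> = (-2 * of_nat (Suc n)) * poly (hermite n) \<beta>"
      by (simp add: poly_hermite_rec del: of_nat_Suc)
  qed
  also have "\<dots> = (-2 * of_nat (Suc n)) ^ Suc n * (\<Prod>\<beta>\<in>#proots (hermite (Suc n)). poly (hermite n) \<beta>)"
    unfolding prod_mset_cmult size_proots_complex degree_hermite ..
  finally have step: "(\<Prod>\<beta>\<in>#proots (hermite (Suc n)). poly (hermite (Suc (Suc n))) \<beta>) = \<dots>" .
  \<comment> \<open>a product of two consecutive numbers is even\<close>
  have "(-1 :: complex) ^ (Suc (Suc n) * Suc n) = 1" by (simp add: uminus_power_if)
  moreover have "((2::complex) ^ Suc n) ^ Suc (Suc n) = 4 ^ Suc n * (2 ^ Suc n) ^ n"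
  proof -
    have "Suc n * Suc (Suc n) = 2 * Suc n + Suc n * n" by simp
    moreover have "(4::complex) = 2 ^ 2" by simp
    ultimately show ?thesis by (simp only: power_mult[symmetric] power_add[symmetric])
  qed
  moreover have "(-8 * of_nat (Suc n) :: complex) ^ Suc n = 4 ^ Suc n * (-2 * of_nat (Suc n)) ^ Suc n"
    unfolding power_mult_distrib[symmetric] by simp
  ultimately show ?thesis
    unfolding Res_prod_right[of "hermite (Suc (Suc n))"] Res_prod_left[of "hermite (Suc n)"]
      degree_hermite lead_coeff_hermite step
    by (simp only: mult_ac mult_1)
qed

lemma Res_hermite:
  "Res (hermite (Suc n)) (hermite n) = (-8) ^ (n * (n + 1) div 2) * (\<Prod>k = 1..n. of_nat k ^ k)"
proof (induction n)
  case 0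
  show ?case by (simp add: Res_prod_left hermite_def)
next
  case (Suc n)
  have "Suc n * (Suc n + 1) div 2 = n * (n + 1) div 2 + Suc n" by simp
  then show ?case
    unfolding Res_hermite_Suc Suc.IH
    by (simp only: power_add power_mult_distrib prod.nat_ivl_Suc' le_add1 plus_1_eq_Suc mult_ac)
qed

text \<open>Both sides compute the resultant of \<open>H\<close> and \<open>H + t H\<^sub>k\<close>, where \<open>H = H\<^sub>k\<^sub>+\<^sub>1\<close>: the
  left one over the roots of the second polynomial, the right one over the roots of \<open>H\<close>, where the
  second polynomial takes the value \<open>t H\<^sub>k\<close>. The power of two makes up for the degree of the second
  argument, which is \<open>k + 1\<close> for \<open>H + t H\<^sub>k\<close> but \<open>k\<close> for \<open>H\<^sub>k\<close>.\<close>
lemma prod_hermite_proots_pert: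
  "(\<Prod>\<beta>\<in>#proots (hermite_pert (Suc k) t). poly (hermite (Suc k)) \<beta>) * 2 ^ (k * Suc k) =
     (- t) ^ Suc k * Res (hermite (Suc k)) (hermite k)"
proof -
  let ?H = "hermite (Suc k)" and ?g = "hermite_pert (Suc k) t"
  have "(\<Prod>\<alpha>\<in>#proots ?H. poly ?g \<alpha>) = (\<Prod>\<alpha>\<in>#proots ?H. t * poly (hermite k) \<alpha>)"
  proof (intro arg_cong[where f = prod_mset] image_mset_cong)
    fix \<alpha> assume "\<alpha> \<in># proots ?H"
    then have "poly ?H \<alpha> = 0" by (cases "?H = 0") auto
    then show "poly ?g \<alpha> = t * poly (hermite k) \<alpha>" by (simp add: hermite_pert_def)
  qed
  also have "\<dots> = t ^ Suc k * (\<Prod>\<alpha>\<in>#proots ?H. poly (hermite k) \<alpha>)"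
    unfolding prod_mset_cmult size_proots_complex degree_hermite ..
  finally have g: "(\<Prod>\<alpha>\<in>#proots ?H. poly ?g \<alpha>) = \<dots>" .
  have "(-1) ^ (Suc k * Suc k) * (2 ^ Suc k) ^ Suc k * (\<Prod>\<beta>\<in>#proots ?g. poly ?H \<beta>) =
        (2 ^ Suc k) ^ Suc k * (t ^ Suc k * (\<Prod>\<alpha>\<in>#proots ?H. poly (hermite k) \<alpha>))"
    using Res_prod_right[of ?H ?g] Res_prod_left[of ?H ?g]
    unfolding degree_hermite degree_hermite_pert lead_coeff_hermite lead_coeff_hermite_pert g by simp
  moreover have "(-1 :: complex) ^ (Suc k * Suc k) = (-1) ^ Suc k" by (simp add: uminus_power_if)
  ultimately have "(2 ^ Suc k) ^ Suc k * ((-1) ^ Suc k * (\<Prod>\<beta>\<in>#proots ?g. poly ?H \<beta>)) =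
        (2 ^ Suc k) ^ Suc k * (t ^ Suc k * (\<Prod>\<alpha>\<in>#proots ?H. poly (hermite k) \<alpha>))"
    by (simp only: mult_ac)
  moreover have "((2::complex) ^ Suc k) ^ Suc k \<noteq> 0" by simp
  ultimately have "(-1) ^ Suc k * (\<Prod>\<beta>\<in>#proots ?g. poly ?H \<beta>) =
        t ^ Suc k * (\<Prod>\<alpha>\<in>#proots ?H. poly (hermite k) \<alpha>)"
    using mult_left_cancel by blast
  then have "(-1) ^ Suc k * ((-1) ^ Suc k * (\<Prod>\<beta>\<in>#proots ?g. poly ?H \<beta>)) =
        (- t) ^ Suc k * (\<Prod>\<alpha>\<in>#proots ?H. poly (hermite k) \<alpha>)"
    unfolding power_minus[of t] by (simp only: mult.assoc)
  then have "(\<Prod>\<beta>\<in>#proots ?g. poly ?H \<beta>) = (- t) ^ Suc k * (\<Prod>\<alpha>\<in>#proots ?H. poly (hermite k) \<alpha>)"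
    by (simp only: mult.assoc[symmetric] power_mult_distrib[symmetric]) simp
  moreover have "Res ?H (hermite k) = 2 ^ (k * Suc k) * (\<Prod>\<alpha>\<in>#proots ?H. poly (hermite k) \<alpha>)"
    by (simp add: Res_prod_left degree_hermite lead_coeff_hermite mult.commute flip: power_mult
          del: power_Suc)
  ultimately show ?thesis by (simp only: mult_ac)
qed

text \<open>The theorem for \<open>t \<noteq> 0\<close>, with \<open>n = k + 2\<close> and the resultant of consecutive Hermite polynomials
  not yet evaluated. The factor \<open>t\<^bsup>k + 1\<^esup>\<close> comes from \<open>prod_hermite_proots_pert\<close> and one more \<open>t\<close>
  from expressing \<open>g(u)\<close> by \<open>f(u)\<close>.\<close>
lemma Res_hermite_pert_nonzero:
  fixes k :: nat and s t :: complex
  assumes t: "t \<noteq> 0"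
  defines "u \<equiv> - (2 * of_nat (Suc k) + s * t) / (2 * t)"
  shows "Res (hermite_pert (Suc (Suc k)) s) (hermite_pert (Suc k) t) =
     - (2 ^ (2 * k + 1) / of_nat (Suc k)) * Res (hermite (Suc k)) (hermite k)
       * (t ^ Suc (Suc k) * poly (hermite_pert (Suc (Suc k)) s) u)"
proof -
  let ?f = "hermite_pert (Suc (Suc k)) s" and ?g = "hermite_pert (Suc k) t"
  let ?H = "hermite (Suc k)" and ?K = "of_nat (Suc k) :: complex"
  have K: "?K \<noteq> 0" by (rule of_nat_neq_0)
  \<comment> \<open>\<open>u\<close> is the zero of the linear polynomial that multiplies \<open>H\<close> when \<open>H\<^sub>k\<close> is eliminated
    from \<open>f\<close> by means of \<open>g\<close>\<close>
  have key: "poly ?f x = 2 * (x - u) * poly ?H x - 2 * ?K / t * poly ?g x" for x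
    unfolding hermite_pert_def u_def using t
    by (simp add: poly_hermite_rec field_simps del: of_nat_Suc)
  have gu: "poly ?g u = - t / (2 * ?K) * poly ?f u"
    using key[of u] t K by (simp add: field_simps del: of_nat_Suc)
  have "(\<Prod>\<beta>\<in>#proots ?g. poly ?f \<beta>) = (\<Prod>\<beta>\<in>#proots ?g. -2 * ((u - \<beta>) * poly ?H \<beta>))"
  proof (intro arg_cong[where f = prod_mset] image_mset_cong)
    fix \<beta> assume "\<beta> \<in># proots ?g"
    then have "poly ?g \<beta> = 0" by (cases "?g = 0") auto
    then show "poly ?f \<beta> = -2 * ((u - \<beta>) * poly ?H \<beta>)" by (simp add: key algebra_simps)
  qed
  also have "\<dots> = (-2) ^ Suc k * ((\<Prod>\<beta>\<in>#proots ?g. u - \<beta>) * (\<Prod>\<beta>\<in>#proots ?g. poly ?H \<beta>))"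
    unfolding prod_mset_cmult size_proots_complex degree_hermite_pert by (simp add: prod_mset.distrib)
  also have "(-2) ^ Suc k = (-1 :: complex) ^ Suc k * 2 ^ Suc k"
    by (rule power_minus)
  finally have prod_f: "(\<Prod>\<beta>\<in>#proots ?g. poly ?f \<beta>) =
      (-1) ^ Suc k * poly ?g u * (\<Prod>\<beta>\<in>#proots ?g. poly ?H \<beta>)"
    unfolding poly_conv_prod_proots[of ?g u] degree_hermite_pert lead_coeff_hermite_pert
    by (simp only: mult_ac)
  have "(-1 :: complex) ^ (Suc (Suc k) * Suc k) = 1" by (simp add: uminus_power_if)
  then have "Res ?f ?g = (2 ^ Suc k) ^ Suc (Suc k) *
      ((-1) ^ Suc k * poly ?g u * (\<Prod>\<beta>\<in>#proots ?g. poly ?H \<beta>))"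
    unfolding Res_prod_right[of ?f] degree_hermite_pert lead_coeff_hermite_pert prod_f by simp
  also have "((2::complex) ^ Suc k) ^ Suc (Suc k) = 2 ^ (2 * k + 2) * 2 ^ (k * Suc k)"
  proof -
    have "Suc k * Suc (Suc k) = (2 * k + 2) + k * Suc k" by simp
    then show ?thesis by (simp only: power_mult[symmetric] power_add[symmetric])
  qed
  also have "2 ^ (2 * k + 2) * 2 ^ (k * Suc k) *
        ((-1) ^ Suc k * poly ?g u * (\<Prod>\<beta>\<in>#proots ?g. poly ?H \<beta>)) =
      2 ^ (2 * k + 2) * poly ?g u * (-1) ^ Suc k * ((\<Prod>\<beta>\<in>#proots ?g. poly ?H \<beta>) * 2 ^ (k * Suc k))"
    by (simp only: mult_ac)
  also have "\<dots> = 2 ^ (2 * k + 2) * poly ?g u * ((-1) ^ Suc k * (- t) ^ Suc k) * Res ?H (hermite k)"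
    unfolding prod_hermite_proots_pert by (simp only: mult_ac)
  also have "(-1) ^ Suc k * (- t) ^ Suc k = t ^ Suc k"
    unfolding power_mult_distrib[symmetric] by simp
  finally show ?thesis
    unfolding gu using K by (simp add: field_simps del: of_nat_Suc)
qed

text \<open>For the passage to \<open>t = 0\<close>: the roots of \<open>f = H\<^sub>n + s H\<^sub>n\<^sub>-\<^sub>1\<close> do not depend on \<open>t\<close>, and at each of
  them the second polynomial has a value linear in \<open>t\<close>.\<close>
lemma Res_hermite_pert_poly:
  obtains Q where "\<And>t. Res (hermite_pert n s) (hermite_pert (Suc k) t) = poly Q t"
proof
  let ?f = "hermite_pert n s"
  show "Res ?f (hermite_pert (Suc k) t) =
     poly (smult (lead_coeff ?f ^ Suc k)
       (\<Prod>\<alpha>\<in>#proots ?f. [:poly (hermite (Suc k)) \<alpha>, poly (hermite k) \<alpha>:])) t" for t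
  proof -
    have "poly (hermite_pert (Suc k) t) = (\<lambda>\<alpha>. poly (hermite (Suc k)) \<alpha> + t * poly (hermite k) \<alpha>)"
      by (simp add: fun_eq_iff hermite_pert_def)
    then show ?thesis
      by (simp add: Res_prod_left degree_hermite_pert poly_prod_mset image_mset.compositionality o_def)
  qed
qed

lemma poly_eqI_nonzero:
  fixes p q :: "'a :: {idom, ring_char_0} poly"
  assumes "\<And>t. t \<noteq> 0 \<Longrightarrow> poly p t = poly q t"
  shows "p = q"
proof (rule ccontr)
  assume "p \<noteq> q"
  then have "finite {t. poly (p - q) t = 0}" by (intro poly_roots_finite) simp
  moreover have "UNIV - {0} \<subseteq> {t. poly (p - q) t = 0}" using assms by auto
  ultimately have "finite (UNIV - {0 :: 'a})" by (rule finite_subset[rotated])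
  then show False by (simp add: infinite_UNIV_char_0)
qed

theorem theorem3p6:
  fixes n :: nat and s t :: complex
  assumes "n \<ge> 2"
  shows "Res (hermite_pert n s) (hermite_pert (n - 1) t) =
           (-1) ^ (n * (n + 1) div 2) * 2 ^ (n * (3 * n - 5) div 2) / (of_nat n - 1) ^ n
             * (\<Prod>k = 1..n - 1. of_nat k ^ k)
             * poly (hermite_factor n s) t"
proof -
  define k where "k = n - 2"
  have n: "n = Suc (Suc k)" using assms by (simp add: k_def)
  let ?K = "of_nat (Suc k) :: complex"
  define C :: complex where "C = - (2 ^ (2 * k + 1) / ?K) * Res (hermite (Suc k)) (hermite k)"
  obtain Q where Q: "\<And>t. Res (hermite_pert n s) (hermite_pert (Suc k) t) = poly Q t"
    using Res_hermite_pert_poly by blast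
  have "Q = smult C (hermite_factor n s)"
  proof (rule poly_eqI_nonzero)
    fix t :: complex assume t: "t \<noteq> 0"
    have "of_nat n - 1 = ?K" by (simp add: n)
    then show "poly Q t = poly (smult C (hermite_factor n s)) t"
      unfolding Q[symmetric] poly_smult poly_hermite_factor[OF t] C_def
      using Res_hermite_pert_nonzero[OF t, of k s] by (simp only: n)
  qed
  then have main: "Res (hermite_pert n s) (hermite_pert (n - 1) t) = C * poly (hermite_factor n s) t"
    using Q[of t] by (simp add: n)
  \<comment> \<open>both exponents in the claim are expressed by the triangular number \<open>T\<close>, the exponent of
    \<open>-8\<close> in \<open>Res_hermite\<close>; the factor for \<open>i = k + 1\<close> of the product is absorbed by the denominator\<close>
  define T where "T = k * (k + 1) div 2"
  have T: "k * (k + 1) = 2 * T" by (simp add: T_def)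
  have "n * (n + 1) = 2 * (T + 2 * k + 3)" "n * (3 * n - 5) = 2 * (3 * T + 2 * k + 1)"
    using T by (auto simp: n algebra_simps)
  then have e: "n * (n + 1) div 2 = T + 2 * k + 3" "n * (3 * n - 5) div 2 = 3 * T + 2 * k + 1"
    by simp_all
  have "(-1 :: complex) ^ (T + 2 * k + 3) * 2 ^ (3 * T + 2 * k + 1) = - (2 ^ (2 * k + 1)) * (-8) ^ T"
    by (simp add: power_add power_mult power_minus[of 8])
  moreover have "(\<Prod>i = 1..n - 1. (of_nat i :: complex) ^ i) = (\<Prod>i = 1..k. of_nat i ^ i) * ?K ^ Suc k"
    by (simp add: n)
  moreover have "?K \<noteq> 0" by (rule of_nat_neq_0)
  moreover have "of_nat n - 1 = ?K" "?K ^ n = ?K * ?K ^ Suc k" by (simp_all add: n)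
  ultimately have "C = (-1) ^ (n * (n + 1) div 2) * 2 ^ (n * (3 * n - 5) div 2) / (of_nat n - 1) ^ n
             * (\<Prod>k = 1..n - 1. of_nat k ^ k)"
    unfolding C_def Res_hermite e T_def[symmetric] by (simp del: of_nat_Suc power_Suc)
  then show ?thesis using main by simp
qed

end
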